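(* Let $n\ge 1$, let $P$ be the Bergman projection of $L^2(B_n)$ onto $\mathbb{H}^2(B_n)$, and let $X=\sum_{i=1}^n a_i\frac{\partial}{\partial z_i}$, where $a_1,\dots,a_n\in\mathbb{C}$ are constants, not all zero. Then $[X,P]$ does not admit a continuous extension to $L^2(B_n)$; that is, there is no bounded linear operator on $L^2(B_n)$ which agrees with $XP-PX$ on $D$.
   Context: $B_n$ is the open unit ball of $\mathbb{C}^n$, $\mu$ is Lebesgue measure on $\mathbb{C}^n$ normalized so that $\mu(B_n)=1$, and $L^2(B_n)=L^2(B_n,d\mu)$ is the space of square-integrable complex-valued functions. $\mathbb{H}^2(B_n)$ (the Bergman space) is the closed subspace of holomorphic functions in $L^2(B_n)$. The Bergman projection $P:L^2(B_n)\to\mathbb{H}^2(B_n)$ is the orthogonal projection, given by $(Pf)(z)=\int_{B_n}\frac{f(w)}{(1-z\cdot\overline{w})^{n+1}}\,d\mu(w)$ with $z\cdot\overline{w}=\sum_{j=1}^n z_j\overline{w_j}$. $D$ denotes the space of all polynomials in $z_1,\dots,z_n,\overline{z_1},\dots,\overline{z_n}$ with complex coefficients, restricted to $B_n$; it is dense in $L^2(B_n)$ and invariant under $P$ and under the derivations considered, so commutators are well defined on $D$. $\frac{\partial}{\partial z_i}$ is the Wirtinger derivative and $[X,P]=XP-PX$. *)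

theory Defs
  imports "HOL-Analysis.Analysis"
begin

definition unit_ball :: "(complex ^ 'n) set" where
  "unit_ball = ball 0 1"

text \<open>Lebesgue measure on the unit ball, scaled to total mass 1; its underlying space is the
  ball itself, so values of functions outside the ball are irrelevant to measurability and
  integration.\<close>

definition ball_measure :: "(complex ^ 'n) measure" where
  "ball_measure = uniform_measure (lebesgue_on unit_ball) unit_ball"

lemma space_ball_measure: "space ball_measure = unit_ball"
  by (simp add: ball_measure_def uniform_measure_def)

lemma emeasure_ball_measure: "emeasure ball_measure (unit_ball :: (complex ^ 'n) set) = 1"
proof -
  let ?B = "ball 0 1 :: (complex ^ 'n) set"
  have eq: "emeasure (lebesgue_on ?B) ?B = emeasure lborel ?B"
    by (simp add: emeasure_restrict_space)
  have "emeasure lborel ?B \<noteq> 0"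
    using open_not_negligible[of ?B] by (auto simp: negligible_iff_emeasure0)
  moreover have "emeasure lborel ?B \<noteq> \<infinity>"
    using emeasure_lborel_ball_finite[of "0 :: complex ^ 'n" 1] by simp
  ultimately show ?thesis
    unfolding ball_measure_def unit_ball_def using eq
    by (intro emeasure_uniform_measure_1) auto
qed

text \<open>Elements of \<open>L\<^sup>2\<close> are represented by square-integrable functions; equality in \<open>L\<^sup>2\<close> is
  equality almost everywhere and is written out as such below.\<close>

definition L2 :: "(complex ^ 'n \<Rightarrow> complex) set" where
  "L2 = {f. f \<in> borel_measurable ball_measure \<and> integrable ball_measure (\<lambda>z. (cmod (f z))\<^sup>2)}"

definition L2_inner :: "(complex ^ 'n \<Rightarrow> complex) \<Rightarrow> (complex ^ 'n \<Rightarrow> complex) \<Rightarrow> complex" where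
  "L2_inner f g = (LINT z|ball_measure. f z * cnj (g z))"

definition L2_norm :: "(complex ^ 'n \<Rightarrow> complex) \<Rightarrow> real" where
  "L2_norm f = sqrt (LINT z|ball_measure. (cmod (f z))\<^sup>2)"

text \<open>A map on representatives with these properties sends a.e. equal functions to a.e. equal
  functions (the norm bound makes it do so), hence is the same thing as a bounded
  complex-linear operator on the quotient.\<close>

definition bounded_linear_on_L2 ::
    "((complex ^ 'n \<Rightarrow> complex) \<Rightarrow> (complex ^ 'n \<Rightarrow> complex)) \<Rightarrow> bool" where
  "bounded_linear_on_L2 T \<longleftrightarrow>
     (\<forall>f\<in>L2. T f \<in> L2) \<and>
     (\<forall>f\<in>L2. \<forall>g\<in>L2. AE z in ball_measure. T (\<lambda>w. f w + g w) z = T f z + T g z) \<and>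
     (\<forall>c. \<forall>f\<in>L2. AE z in ball_measure. T (\<lambda>w. c * f w) z = c * T f z) \<and>
     (\<exists>C. \<forall>f\<in>L2. L2_norm (T f) \<le> C * L2_norm f)"

text \<open>Holomorphy in several variables: complex differentiability at every point, i.e. the
  Frechet derivative is a complex-linear functional.\<close>

definition holomorphic_multi :: "(complex ^ 'n \<Rightarrow> complex) \<Rightarrow> (complex ^ 'n) set \<Rightarrow> bool" where
  "holomorphic_multi f S \<longleftrightarrow>
     (\<forall>z\<in>S. \<exists>d :: complex ^ 'n. (f has_derivative (\<lambda>h. \<Sum>i\<in>UNIV. d $ i * h $ i)) (at z))"

definition bergman_space :: "(complex ^ 'n \<Rightarrow> complex) set" where
  "bergman_space = {f \<in> L2. holomorphic_multi f unit_ball}"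

text \<open>Orthogonal projection of \<open>L\<^sup>2\<close> onto the Bergman space. The value \<open>P f\<close> is the holomorphic
  representative, so it is determined at every point of the ball.\<close>

definition bergman_projection ::
    "((complex ^ 'n \<Rightarrow> complex) \<Rightarrow> (complex ^ 'n \<Rightarrow> complex)) \<Rightarrow> bool" where
  "bergman_projection P \<longleftrightarrow>
     (\<forall>f\<in>L2. P f \<in> bergman_space \<and> (\<forall>h\<in>bergman_space. L2_inner (\<lambda>z. f z - P f z) h = 0))"

text \<open>Polynomials in the coordinates and their conjugates; on the ball each of them determines
  and is determined by its restriction.\<close>

definition ball_polys :: "(complex ^ 'n \<Rightarrow> complex) set" where
  "ball_polys = {f. \<exists>(A :: (('n \<Rightarrow> nat) \<times> ('n \<Rightarrow> nat)) set) c. finite A \<and>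
     f = (\<lambda>z. \<Sum>(\<alpha>, \<beta>)\<in>A. c \<alpha> \<beta> * ((\<Prod>i\<in>UNIV. (z $ i) ^ \<alpha> i) * (\<Prod>i\<in>UNIV. cnj (z $ i) ^ \<beta> i)))}"

text \<open>With \<open>z\<^sub>i = x\<^sub>i + \<i> y\<^sub>i\<close>: half of the \<open>x\<^sub>i\<close>-derivative minus \<open>\<i>\<close> times the \<open>y\<^sub>i\<close>-derivative.\<close>

definition wirtinger_deriv :: "'n \<Rightarrow> (complex ^ 'n \<Rightarrow> complex) \<Rightarrow> complex ^ 'n \<Rightarrow> complex" where
  "wirtinger_deriv i f z =
     (vector_derivative (\<lambda>t::real. f (z + t *\<^sub>R axis i 1)) (at 0)
      - \<i> * vector_derivative (\<lambda>t::real. f (z + t *\<^sub>R axis i \<i>)) (at 0)) / 2"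

definition const_derivation ::
    "complex ^ 'n \<Rightarrow> (complex ^ 'n \<Rightarrow> complex) \<Rightarrow> complex ^ 'n \<Rightarrow> complex" where
  "const_derivation a f z = (\<Sum>i\<in>UNIV. a $ i * wirtinger_deriv i f z)"

definition commutator ::
    "(('a \<Rightarrow> complex) \<Rightarrow> ('a \<Rightarrow> complex)) \<Rightarrow> (('a \<Rightarrow> complex) \<Rightarrow> ('a \<Rightarrow> complex))
      \<Rightarrow> ('a \<Rightarrow> complex) \<Rightarrow> 'a \<Rightarrow> complex" where
  "commutator X P f z = X (P f) z - P (X f) z"

end

theory Submission
  imports Defs "HOL-Complex_Analysis.Cauchy_Integral_Formula"
begin

text \<open>Fix a coordinate \<open>i\<close> with \<open>a\<^sub>i \<noteq> 0\<close>, let \<open>M\<^sub>s\<close> be the integral of \<open>\<bar>z\<^sub>i\<bar>\<^sup>2\<^sup>s\<close> over the ball,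
  and test the commutator on \<open>f = z\<^sub>i\<^bsup>p+k\<^esup> cnj z\<^sub>i\<^bsup>k\<^esup>\<close>. Rotating the coordinates shows that \<open>P f\<close> is
  \<open>M\<^bsub>p+k\<^esub>/M\<^sub>p \<cdot> z\<^sub>i\<^sup>p\<close>, so for \<open>p = q + 1\<close> the commutator maps \<open>f\<close> to a multiple of \<open>z\<^sub>i\<^sup>q\<close> with an explicit
  coefficient. The moments need not be computed: boundedness contradicts their log-convexity alone.
  For fixed \<open>k\<close> it forces, for all large \<open>q\<close>, that \<open>R\<^bsub>q+k\<^esub> - R\<^sub>q \<ge> R\<^sub>0/(q+1)\<close> as soon as \<open>k\<close>
  exceeds a multiple of the norm, where \<open>R\<^sub>q = M\<^bsub>q+1\<^esub>/M\<^sub>q\<close>; but \<open>R\<close> increases to a finite limit,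
  so these differences are summable, unlike \<open>1/(q+1)\<close>.\<close>

subsection \<open>Invariance of Lebesgue measure under orthogonal maps\<close>

text \<open>Up to a null set an open set is a disjoint union of balls, whose measure depends on the radius only.\<close>

lemma emeasure_orthogonal_image_open:
  fixes f :: "'a::euclidean_space \<Rightarrow> 'a"
  assumes f: "orthogonal_transformation f" and S: "open S"
  shows "emeasure lebesgue (f ` S) = emeasure lebesgue S"
proof -
  define K where "K = {(x, r). 0 < r \<and> ball x r \<subseteq> S}"
  have "\<exists>i. i \<in> K \<and> x \<in> ball (fst i) (snd i) \<and> snd i < d" if "x \<in> S" "0 < d" for x d
  proof -
    obtain e where e: "e > 0" "ball x e \<subseteq> S"
      using openE[OF S \<open>x \<in> S\<close>] by blast
    \<comment> \<open>Vitali's theorem asks for covering balls of radius below any prescribed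
      \<open>d\<close>; cutting at \<open>d/2\<close> makes the inequality strict.\<close>
    have "ball x (min e (d/2)) \<subseteq> S"
      by (rule order_trans[OF subset_ball e(2)]) simp
    then have "(x, min e (d/2)) \<in> K"
      using e(1) that(2) by (simp add: K_def)
    then show ?thesis
      using e(1) that(2) by (intro exI[of _ "(x, min e (d/2))"]) simp
  qed
  then obtain C where C: "countable C" "C \<subseteq> K"
      and disj: "pairwise (\<lambda>i j. disjnt (ball (fst i) (snd i)) (ball (fst j) (snd j))) C"
      and neg: "negligible (S - (\<Union>i\<in>C. ball (fst i) (snd i)))" (is "negligible ?N")
    by (rule Vitali_covering_theorem_balls[where S = S and a = fst and r = snd and K = K])
  have "ball (fst i) (snd i) \<subseteq> S" if "i \<in> C" for i
    using subsetD[OF C(2) that] by (simp add: K_def case_prod_beta)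
  then have S_eq: "S = (\<Union>i\<in>C. ball (fst i) (snd i)) \<union> ?N"
    by blast
  have null: "?N \<in> null_sets lebesgue" "f ` ?N \<in> null_sets lebesgue"
  proof -
    \<comment> \<open>An orthogonal map is Lipschitz with constant 1, so it sends the exceptional
      null set to a null set.\<close>
    have "norm (f y - f x) \<le> 1 * norm (y - x)" for x y
      using linear_diff[OF orthogonal_transformation_linear[OF f], of y x]
        orthogonal_transformation_norm[OF f, of "y - x"] by simp
    then have "negligible (f ` ?N)"
      by (intro negligible_locally_Lipschitz_image[OF _ neg]) (blast intro: open_UNIV)+
    then show "?N \<in> null_sets lebesgue" "f ` ?N \<in> null_sets lebesgue"
      using neg negligible_iff_null_sets by blast+
  qed
  have em: "emeasure lebesgue (ball (f x) r) = emeasure lebesgue (ball x r)" for x r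
    by (cases "r \<ge> 0") (simp_all add: emeasure_ball ball_empty)
  have "emeasure lebesgue (f ` S) = emeasure lebesgue ((\<Union>i\<in>C. f ` ball (fst i) (snd i)) \<union> f ` ?N)"
    by (subst S_eq) (simp only: image_Un image_UN)
  also have "\<dots> = emeasure lebesgue (\<Union>i\<in>C. f ` ball (fst i) (snd i))"
    using C(1) null f
    by (intro emeasure_Un_null_set sets.countable_UN')
       (auto simp: image_orthogonal_transformation_ball)
  also have "\<dots> = (\<integral>\<^sup>+i. emeasure lebesgue (f ` ball (fst i) (snd i)) \<partial>count_space C)"
  proof (rule emeasure_UN_countable)
    show "disjoint_family_on (\<lambda>i. f ` ball (fst i) (snd i)) C"
      using disj unfolding disjoint_family_on_def pairwise_def disjnt_def
      by (simp flip: image_Int[OF orthogonal_transformation_inj[OF f]])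
  qed (use C f in \<open>auto simp: image_orthogonal_transformation_ball\<close>)
  also have "\<dots> = (\<integral>\<^sup>+i. emeasure lebesgue (ball (fst i) (snd i)) \<partial>count_space C)"
    using f em by (simp add: image_orthogonal_transformation_ball)
  also have "\<dots> = emeasure lebesgue (\<Union>i\<in>C. ball (fst i) (snd i))"
    using disj C unfolding pairwise_def disjnt_def
    by (intro emeasure_UN_countable[symmetric]) (auto simp: disjoint_family_on_def)
  also have "\<dots> = emeasure lebesgue ((\<Union>i\<in>C. ball (fst i) (snd i)) \<union> ?N)"
    using C(1) null by (intro emeasure_Un_null_set[symmetric] sets.countable_UN') auto
  also have "\<dots> = emeasure lebesgue S"
    by (rule arg_cong[OF S_eq[symmetric]])
  finally show ?thesis .
qed

text \<open>Lebesgue measure is determined by its values on boxes. The preimage of a box is open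
  and, by surjectivity, is mapped back onto the box, so the result for open sets gives its
  measure.\<close>

lemma distr_lborel_orthogonal:
  fixes f :: "'a::euclidean_space \<Rightarrow> 'a"
  assumes f: "orthogonal_transformation f"
  shows "distr lborel borel f = lborel"
proof (rule lborel_eqI[symmetric])
  have lin: "linear f" by (rule orthogonal_transformation_linear[OF f])
  then have meas: "f \<in> borel_measurable borel"
    by (intro borel_measurable_continuous_onI linear_continuous_on) (simp add: linear_linear)
  fix l u :: 'a assume lu: "\<And>b. b \<in> Basis \<Longrightarrow> l \<bullet> b \<le> u \<bullet> b"
  let ?V = "f -` box l u"
  have V: "open ?V"
    using lin by (intro open_vimage open_box linear_continuous_on) (simp add: linear_linear)
  have "f ` ?V = box l u"
    by (rule surj_image_vimage_eq[OF orthogonal_transformation_surj[OF f]])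
  then have "emeasure lborel (box l u) = emeasure lborel ?V"
    using emeasure_orthogonal_image_open[OF f V] V by simp
  then show "emeasure (distr lborel borel f) (box l u) = (\<Prod>b\<in>Basis. (u - l) \<bullet> b)"
    using meas lu by (simp add: emeasure_distr)
qed simp

subsection \<open>Log-convex moment sequences\<close>

text \<open>Here \<open>bound\<close> is the squared operator inequality for the test function with
  exponents \<open>q + 1 + k\<close> and \<open>k\<close>; \<open>B\<close> stands for the norm
  bound divided by the modulus of the chosen coefficient.\<close>

lemma moment_quotient_contradiction:
  fixes M :: "nat \<Rightarrow> real"
  assumes pos: "\<And>s. M s > 0" and dec: "\<And>s. M (Suc s) \<le> M s"
    and lconv: "\<And>s. (M (Suc s))\<^sup>2 \<le> M s * M (Suc (Suc s))"
    and bound: "\<And>k q. (real (q + 1) * M (q + k + 1) / M (q + 1) - real (q + k + 1) * M (q + k) / M q)\<^sup>2 * M q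
                  \<le> B\<^sup>2 * M (q + 2 * k + 1)"
  shows False
proof -
  define R where "R q = M (Suc q) / M q" for q
  have R_pos: "R q > 0" for q using pos by (simp add: R_def)
  have R_le: "R q \<le> 1" for q using pos dec by (simp add: R_def)
  have inc: "incseq R"
    using lconv pos by (intro incseq_SucI) (simp add: R_def field_simps power2_eq_square)
  obtain r where r: "R \<longlonglongrightarrow> r" "\<And>q. R q \<le> r"
    using incseq_convergent[OF inc, of 1] R_le by blast
  have r01: "0 < r" "r \<le> 1"
    using R_pos[of 0] r(2)[of 0] LIMSEQ_le_const2[OF r(1), of 1] R_le by auto
  have lim: "(\<lambda>q. M (q + j) / M q) \<longlonglongrightarrow> r ^ j" for j
  proof (induction j)
    case 0
    have "(\<lambda>q. M q / M q) = (\<lambda>q. 1)" using pos by (auto simp: less_imp_neq[symmetric])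
    then show ?case by simp
  next
    case (Suc j)
    have "(\<lambda>q. R (q + j) * (M (q + j) / M q)) \<longlonglongrightarrow> r * r ^ j"
      by (intro tendsto_mult Suc LIMSEQ_ignore_initial_segment r)
    moreover have "(\<lambda>q. R (q + j) * (M (q + j) / M q)) = (\<lambda>q. M (q + Suc j) / M q)"
      using pos by (auto simp: R_def less_imp_neq[symmetric])
    ultimately show ?case by (simp only: power_Suc)
  qed
  \<comment> \<open>Below, the coefficient \<open>?d\<close> is bounded by
    \<open>2 * \<bar>B\<bar>\<close> in modulus. This size of \<open>k\<close> absorbs that error
    and still leaves a surplus of 1 over \<open>q + 1\<close>.\<close>
  obtain k :: nat where k: "real k \<ge> 2 * \<bar>B\<bar> + 1"
    using real_arch_simple by blast
  \<comment> \<open>The quotient equals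
    \<open>(M (q + k))\<^sup>2 / (M q * M (q + 2 * k + 1))\<close>, the weight of
    \<open>?d\<^sup>2\<close> once \<open>bound\<close> is divided by
    \<open>M (q + 2 * k + 1)\<close>. Its limit is 1/r, at least 1, so it eventually exceeds 1/4;
    the square root of 1/4 produces the factor 2 in the choice of \<open>k\<close>.\<close>
  have "(\<lambda>q. (M (q + k) / M q) / (M (q + k + (k + 1)) / M (q + k))) \<longlonglongrightarrow> r ^ k / r ^ (k + 1)"
    using r01 by (intro tendsto_divide lim LIMSEQ_ignore_initial_segment[OF lim]) simp
  moreover have "r ^ k / r ^ (k + 1) > 1 / 4"
  proof -
    have "r ^ k / r ^ (k + 1) = 1 / r" using r01 by simp
    then show ?thesis using r01 by (simp add: less_divide_eq)
  qed
  ultimately have "\<forall>\<^sub>F q in sequentially. (M (q + k) / M q) / (M (q + k + (k + 1)) / M (q + k)) > 1 / 4"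
    by (rule order_tendstoD)
  moreover have "1 / real (q + 1) * R 0 \<le> R (q + k) - R q"
    if *: "(M (q + k) / M q) / (M (q + k + (k + 1)) / M (q + k)) > 1 / 4" for q
  proof -
    \<comment> \<open>This is the coefficient in \<open>bound\<close> with the common factor
      \<open>M (q + k) / M q\<close> taken out.\<close>
    let ?d = "real (q + 1) * (R (q + k) / R q) - real (q + k + 1)"
    have "real (q + 1) * M (q + k + 1) / M (q + 1) - real (q + k + 1) * M (q + k) / M q = M (q + k) / M q * ?d"
    proof -
      have "x * (b * c) / (d * e) - y * c / e = c / e * (x * (b / d) - y)" for x y b c d e :: real
        by (simp add: algebra_simps)
      moreover have "M (q + k + 1) = R (q + k) * M (q + k)" "M (q + 1) = R q * M q"
        using pos[of q] pos[of "q + k"] by (auto simp: R_def)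
      ultimately show ?thesis by metis
    qed
    then have "(M (q + k) / M q * ?d)\<^sup>2 * M q \<le> B\<^sup>2 * M (q + 2 * k + 1)"
      using bound[of q k] by simp
    then have "?d\<^sup>2 * ((M (q + k))\<^sup>2 / (M q * M (q + 2 * k + 1))) \<le> B\<^sup>2"
    proof -
      have "x\<^sup>2 * (y\<^sup>2 / (z * w)) = (y / z * x)\<^sup>2 * z / w" if "z > 0" for x y z w :: real
        using that by (simp add: power2_eq_square)
      then show ?thesis
        using that pos[of q] pos[of "q + 2 * k + 1"]
          \<open>(M (q + k) / M q * ?d)\<^sup>2 * M q \<le> B\<^sup>2 * M (q + 2 * k + 1)\<close>
        by (simp only: pos_divide_le_eq)
    qed
    moreover have "(M (q + k))\<^sup>2 / (M q * M (q + 2 * k + 1)) \<ge> 1 / 4"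
    proof -
      have "q + k + (k + 1) = q + 2 * k + 1" by simp
      with * have "(M (q + k) / M q) / (M (q + 2 * k + 1) / M (q + k)) > 1 / 4" by metis
      then show ?thesis by (simp add: power2_eq_square)
    qed
    ultimately have "?d\<^sup>2 * (1 / 4) \<le> B\<^sup>2"
      by (meson mult_left_mono order_trans zero_le_power2)
    then have "?d\<^sup>2 \<le> (2 * \<bar>B\<bar>)\<^sup>2" by (simp add: power_mult_distrib)
    then have "\<bar>?d\<bar> \<le> 2 * \<bar>B\<bar>"
      using abs_le_square_iff[of ?d "2 * \<bar>B\<bar>"] by simp
    then have "real (q + 1) * (R (q + k) / R q) \<ge> real (q + 1) + 1"
      using k by linarith
    then have "real (q + 1) * R (q + k) \<ge> (real (q + 1) + 1) * R q"
      using R_pos[of q] by (simp add: field_simps)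
    \<comment> \<open>The surplus is \<open>R q\<close>, and monotonicity replaces it by the
      constant \<open>R 0\<close>.\<close>
    then have "real (q + 1) * (R (q + k) - R q) \<ge> R 0"
      using incseqD[OF inc, of 0 q] by (simp add: algebra_simps)
    then show ?thesis by (simp add: field_simps)
  qed
  ultimately have ev: "\<forall>\<^sub>F q in sequentially. norm (1 / real (q + 1) * R 0) \<le> R (q + k) - R q"
    using R_pos[of 0] by (auto elim!: eventually_mono)
  \<comment> \<open>The difference over \<open>j\<close> steps is a sum of \<open>j\<close> one-step
    differences, and each of these series telescopes because \<open>R\<close> converges.\<close>
  have "summable (\<lambda>q. R (q + j) - R q)" for j
  proof (induction j)
    case (Suc j)
    have "summable (\<lambda>q. R (Suc (q + j)) - R (q + j))"
      using telescope_summable[OF LIMSEQ_ignore_initial_segment[OF r(1), of j]] by simp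
    from summable_add[OF this Suc] show ?case by simp
  qed simp
  then have "summable (\<lambda>q. 1 / real (q + 1) * R 0)"
    by (rule summable_comparison_test_ev[OF ev])
  then have "summable (\<lambda>q. inverse (real (Suc q)))"
    using R_pos[of 0] summable_mult2[of _ "1 / R 0"] by (fastforce simp: inverse_eq_divide)
  then have "summable (\<lambda>q. inverse (real q))"
    by (subst (asm) summable_Suc_iff)
  then show False
    using not_summable_harmonic[where 'a=real] by simp
qed

subsection \<open>Integration over the circle and the unit ball\<close>

text \<open>Cauchy's formula for the derivative of order \<open>p\<close> at 0, with the unit circle
  parametrized by [0,1]. The case \<open>p = 0\<close> is the mean value property; general
  \<open>p\<close> extracts a Taylor coefficient.\<close>

lemma circle_average:
  fixes \<phi> :: "complex \<Rightarrow> complex"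
  assumes S: "open S" "cball 0 1 \<subseteq> S" and hol: "\<phi> holomorphic_on S"
  shows "(LINT t|lebesgue_on {0..1}. \<phi> (cis (2 * pi * t)) * cis (- (2 * pi * real p * t)))
           = (deriv ^^ p) \<phi> 0 / fact p"
proof -
  let ?g = "\<lambda>t. \<phi> (cis (2 * pi * t)) * cis (- (2 * pi * real p * t))"
  have cont: "continuous_on (cball 0 1) \<phi>"
    using hol S holomorphic_on_imp_continuous_on continuous_on_subset by blast
  have g_cont: "continuous_on {0..1} ?g"
    unfolding cis_conv_exp
    by (intro continuous_intros continuous_on_compose2[OF cont]) (auto simp flip: cis_conv_exp)
  have "(deriv ^^ p) \<phi> 0 = fact p / (2 * pi * \<i>) * contour_integral (circlepath 0 1) (\<lambda>u. \<phi> u / (u - 0) ^ Suc p)"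
    using holomorphic_on_subset[OF hol order_trans[OF ball_subset_cball S(2)]]
    by (intro Cauchy_higher_derivative_integral_circlepath[OF cont]) auto
  also have "contour_integral (circlepath 0 1) (\<lambda>u. \<phi> u / (u - 0) ^ Suc p)
      = integral {0..1} (\<lambda>t. 2 * pi * \<i> * ?g t)"
    unfolding contour_integral_integral
  proof (intro integral_cong)
    fix t :: real assume t: "t \<in> {0..1}"
    have e: "circlepath 0 1 t = cis (2 * pi * t)"
      by (simp add: circlepath cis_conv_exp mult_ac)
    have d: "vector_derivative (circlepath 0 1) (at t) = 2 * pi * \<i> * cis (2 * pi * t)"
      using vector_derivative_circlepath[of 0 1 t] by (simp add: cis_conv_exp mult_ac)
    \<comment> \<open>The velocity of the path supplies one factor \<open>cis (2 * pi * t)\<close>,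
      which cancels one of the \<open>Suc p\<close> factors in the denominator.\<close>
    have "cis (2 * pi * t) ^ Suc p * cis (- (2 * pi * real p * t)) = cis (2 * pi * t)"
      unfolding Complex.DeMoivre cis_mult by (rule arg_cong[of _ _ cis]) (simp add: algebra_simps)
    then show "\<phi> (circlepath 0 1 t) / (circlepath 0 1 t - 0) ^ Suc p * vector_derivative (circlepath 0 1) (at t)
        = 2 * pi * \<i> * ?g t"
      unfolding e d by (simp add: field_simps del: power_Suc)
  qed
  also have "\<dots> = 2 * pi * \<i> * integral {0..1} ?g"
    by (intro integral_mult_right)
  also have "integral {0..1} ?g = (LINT t|lebesgue_on {0..1}. ?g t)"
    using g_cont by (intro lebesgue_integral_eq_integral[symmetric] continuous_imp_integrable_real) auto
  finally show ?thesis by simp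
qed

section \<open>Measurability, null sets and orthogonal invariance on the ball\<close>

lemma open_unit_ball [simp]: "open (unit_ball :: (complex ^ 'n) set)"
  by (simp add: unit_ball_def)

lemma sets_ball_measure [measurable_cong]:
  "sets (ball_measure :: (complex ^ 'n) measure) = sets (lebesgue_on unit_ball)"
  by (simp add: ball_measure_def)

lemma finite_measure_ball_measure: "finite_measure (ball_measure :: (complex ^ 'n) measure)"
  by (rule finite_measureI) (simp add: emeasure_ball_measure space_ball_measure)

lemma borel_measurable_ball_measureI:
  fixes f :: "complex ^ 'n \<Rightarrow> 'b::euclidean_space"
  assumes "continuous_on unit_ball f"
  shows "f \<in> borel_measurable ball_measure"
  unfolding measurable_cong_sets[OF sets_ball_measure refl]
  using assms by (intro continuous_imp_measurable_on_sets_lebesgue) auto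

text \<open>\<open>ball_measure\<close> carries the Lebesgue measurable sets, while image measures
  and compositions are handled on Borel sets. The identity is the bridge, and its target admits
  functions that are continuous on the ball only.\<close>

lemma measurable_ident_ball_measure [measurable]:
  "(\<lambda>z. z) \<in> measurable ball_measure (restrict_space borel (unit_ball :: (complex ^ 'n) set))"
proof (rule measurable_restrict_space2)
  show "(\<lambda>z. z) \<in> borel_measurable (ball_measure :: (complex ^ 'n) measure)"
    unfolding measurable_cong_sets[OF sets_ball_measure refl]
    using id_borel_measurable_lebesgue_on by (simp add: id_def)
qed (simp add: space_ball_measure)

text \<open>Two continuous functions differ on an open set, and a nonempty open set is not null.
  Pointwise equality matters because projections are going to be differentiated.\<close>

lemma AE_ball_measure_imp_eq:
  fixes f g :: "complex ^ 'n \<Rightarrow> complex"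
  assumes ae: "AE z in ball_measure. f z = g z"
    and f: "continuous_on unit_ball f" and g: "continuous_on unit_ball g" and z: "z \<in> unit_ball"
  shows "f z = g z"
proof (rule ccontr)
  assume ne: "f z \<noteq> g z"
  let ?U = "unit_ball \<inter> (\<lambda>z. f z - g z) -` (- {0})"
  have U: "open ?U"
    using continuous_open_preimage[OF continuous_on_diff[OF f g] open_unit_ball open_Compl[OF closed_singleton]] .
  have "emeasure ball_measure ?U = 0"
    using AE_E2[OF ae] by (simp add: space_ball_measure Int_def)
  moreover have "emeasure ball_measure ?U = emeasure lebesgue ?U / emeasure lebesgue (unit_ball :: (complex ^ 'n) set)"
  proof -
    have "unit_ball \<inter> ?U = ?U" by auto
    moreover have "?U \<in> sets (lebesgue_on unit_ball)"
      using U by (auto simp: sets_restrict_space_iff)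
    ultimately show ?thesis
      unfolding ball_measure_def
      by (subst emeasure_uniform_measure) (auto simp: emeasure_restrict_space sets_restrict_space_iff)
  qed
  \<comment> \<open>An extended quotient also vanishes when its denominator is infinite, so this
    case has to be excluded.\<close>
  moreover have "emeasure lebesgue (unit_ball :: (complex ^ 'n) set) \<noteq> \<infinity>"
    using emeasure_lborel_ball_finite[of "0 :: complex ^ 'n" 1] by (simp add: unit_ball_def)
  ultimately have "emeasure lebesgue ?U = 0"
    by (auto simp: ennreal_divide_eq_0_iff)
  then have "negligible ?U"
    using U by (auto simp: negligible_iff_null_sets)
  moreover have "z \<in> ?U"
    using z ne by simp
  ultimately show False
    using open_not_negligible[OF U] by (metis empty_iff)
qed

text \<open>The map preserves the ball and Lebesgue measure, so it and the identity push
  \<open>ball_measure\<close> forward to the same measure on the Borel sets of the ball; both claims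
  are the change of variables for these two images.\<close>

lemma integral_ball_measure_orthogonal:
  fixes f :: "complex ^ 'n \<Rightarrow> complex ^ 'n" and F :: "complex ^ 'n \<Rightarrow> 'b::{banach, second_countable_topology}"
  assumes f: "orthogonal_transformation f" and F: "continuous_on unit_ball F"
  shows "(LINT z|ball_measure. F (f z)) = (LINT z|ball_measure. F z)"
    and "integrable ball_measure F \<Longrightarrow> integrable ball_measure (\<lambda>z. F (f z))"
proof -
  let ?B = "restrict_space borel unit_ball :: (complex ^ 'n) measure"
  have lin: "linear f" by (rule orthogonal_transformation_linear[OF f])
  have f_meas: "f \<in> borel_measurable borel"
    using lin by (intro borel_measurable_continuous_onI linear_continuous_on) (simp add: linear_linear)
  have f_ball: "f x \<in> unit_ball \<longleftrightarrow> x \<in> unit_ball" for x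
    by (simp add: unit_ball_def orthogonal_transformation_norm[OF f])
  have f_measB: "f \<in> measurable ball_measure ?B"
  proof (rule measurable_restrict_space2)
    have "(\<lambda>z. f z) \<in> borel_measurable ?B"
      using measurable_restrict_space1[OF f_meas] by simp
    then show "f \<in> borel_measurable ball_measure"
      using measurable_compose[OF measurable_ident_ball_measure] by blast
  qed (simp add: space_ball_measure f_ball)
  have F_meas: "F \<in> borel_measurable ?B"
    by (rule borel_measurable_continuous_on_restrict[OF F])
  have em: "emeasure ball_measure X = emeasure lborel X / emeasure lborel (unit_ball :: (complex ^ 'n) set)"
    if "X \<in> sets borel" "X \<subseteq> unit_ball" for X :: "(complex ^ 'n) set"
  proof -
    have "unit_ball \<inter> X = X" using that by auto
    then show ?thesis
      unfolding ball_measure_def using that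
      by (subst emeasure_uniform_measure) (auto simp: emeasure_restrict_space sets_restrict_space_iff unit_ball_def)
  qed
  have eq: "distr ball_measure ?B f = distr ball_measure ?B (\<lambda>z. z)"
  proof (rule measure_eqI)
    fix X assume "X \<in> sets (distr ball_measure ?B f)"
    then have X: "X \<in> sets borel" "X \<subseteq> unit_ball" "X \<in> sets ?B"
      by (auto simp: sets_restrict_space_iff unit_ball_def)
    have V: "f -` X \<inter> space ball_measure = f -` X"
      using X f_ball by (auto simp: space_ball_measure)
    have "emeasure (distr ball_measure ?B f) X = emeasure ball_measure (f -` X)"
      using X f_measB by (simp add: emeasure_distr V)
    also have "\<dots> = emeasure lborel (f -` X) / emeasure lborel (unit_ball :: (complex ^ 'n) set)"
      using X f_ball measurable_sets[OF f_meas X(1)] by (intro em) auto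
    also have "emeasure lborel (f -` X) = emeasure (distr lborel borel f) X"
      using X f_meas by (simp add: emeasure_distr)
    also have "\<dots> / emeasure lborel (unit_ball :: (complex ^ 'n) set) = emeasure ball_measure X"
      using X by (simp add: em distr_lborel_orthogonal[OF f])
    also have "\<dots> = emeasure (distr ball_measure ?B (\<lambda>z. z)) X"
      using X by (subst emeasure_distr) (auto simp: space_ball_measure intro!: arg_cong2[where f=emeasure])
    finally show "emeasure (distr ball_measure ?B f) X = emeasure (distr ball_measure ?B (\<lambda>z. z)) X" .
  qed simp
  show "(LINT z|ball_measure. F (f z)) = (LINT z|ball_measure. F z)"
    using integral_distr[OF f_measB F_meas] integral_distr[OF measurable_ident_ball_measure F_meas] eq by simp
  show "integrable ball_measure (\<lambda>z. F (f z))" if "integrable ball_measure F"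
    using that integrable_distr_eq[OF f_measB F_meas] integrable_distr_eq[OF measurable_ident_ball_measure F_meas] eq
    by simp
qed

section \<open>Averages over rotations of a set of coordinates\<close>

definition rotate_coords :: "'n set \<Rightarrow> real \<Rightarrow> complex ^ 'n \<Rightarrow> complex ^ 'n" where
  "rotate_coords J t z = (\<chi> j. if j \<in> J then cis t * z $ j else z $ j)"

lemma rotate_coords_nth [simp]:
  "rotate_coords J t z $ j = (if j \<in> J then cis t * z $ j else z $ j)"
  by (simp add: rotate_coords_def)

lemma orthogonal_rotate_coords: "orthogonal_transformation (rotate_coords J t)"
  unfolding orthogonal_transformation
proof
  show "linear (rotate_coords J t)"
    by (rule linearI) (auto simp: vec_eq_iff algebra_simps scaleR_conv_of_real)
  show "\<forall>v. norm (rotate_coords J t v) = norm v"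
    by (auto simp: norm_vec_def norm_mult intro!: L2_set_cong)
qed

lemma rotate_coords_in_unit_ball [simp]: "rotate_coords J t z \<in> unit_ball \<longleftrightarrow> z \<in> unit_ball"
  by (simp add: unit_ball_def orthogonal_transformation_norm[OF orthogonal_rotate_coords])

text \<open>Fubini: for each fixed angle the integral over the ball is that of \<open>F\<close>, by
  orthogonal invariance, and [0,1] has length 1. Later \<open>J\<close> is the complement of one
  coordinate, then that coordinate alone.\<close>

lemma integral_average_rotation:
  fixes F :: "complex ^ 'n \<Rightarrow> complex" and J :: "'n set"
  assumes F: "continuous_on unit_ball F" and int: "integrable ball_measure F"
  defines "avg \<equiv> \<lambda>z. LINT t|lebesgue_on {0..1}. F (rotate_coords J (2 * pi * t) z)"
  shows "integrable ball_measure avg" and "(LINT z|ball_measure. avg z) = (LINT z|ball_measure. F z)"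
proof -
  let ?I = "lebesgue_on {0..1::real}"
  let ?B = "ball_measure :: (complex ^ 'n) measure"
  let ?R = "\<lambda>p :: real \<times> (complex ^ 'n). rotate_coords J (2 * pi * fst p) (snd p)"
  interpret I: finite_measure ?I
    by (rule finite_measure_lebesgue_on) simp
  interpret B: finite_measure ?B
    by (rule finite_measure_ball_measure)
  interpret IB: pair_sigma_finite ?I ?B ..
  have meas: "(\<lambda>p. F (?R p)) \<in> borel_measurable (?I \<Otimes>\<^sub>M ?B)"
  proof -
    have "continuous_on UNIV ?R"
      unfolding rotate_coords_def cis_conv_exp
    proof (rule continuous_on_vec_lambda)
      show "continuous_on UNIV (\<lambda>p. if j \<in> J then exp (\<i> * complex_of_real (2 * pi * fst p)) * snd p $ j
          else snd p $ j)" for j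
        by (cases "j \<in> J") (auto intro!: continuous_intros)
    qed
    then have R: "?R \<in> borel_measurable (borel \<Otimes>\<^sub>M borel)"
      unfolding borel_prod by (rule borel_measurable_continuous_onI)
    have fst: "fst \<in> borel_measurable (?I \<Otimes>\<^sub>M ?B)"
      using measurable_compose[OF measurable_fst id_borel_measurable_lebesgue_on] by (simp add: id_def)
    have "snd \<in> measurable (?I \<Otimes>\<^sub>M ?B) (restrict_space borel unit_ball)"
      using measurable_compose[OF measurable_snd measurable_ident_ball_measure] by simp
    then have snd: "snd \<in> borel_measurable (?I \<Otimes>\<^sub>M ?B)"
      by (rule measurable_restrict_space2_iff[THEN iffD1, THEN conjunct1])
    have "(\<lambda>p. p) \<in> measurable (?I \<Otimes>\<^sub>M ?B) (borel \<Otimes>\<^sub>M borel)"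
      using measurable_Pair[OF fst snd] by simp
    from measurable_compose[OF this R]
    have "?R \<in> measurable (?I \<Otimes>\<^sub>M ?B) (restrict_space borel unit_ball)"
      by (intro measurable_restrict_space2) (auto simp: space_pair_measure space_ball_measure)
    then show ?thesis
      by (rule measurable_compose[OF _ borel_measurable_continuous_on_restrict[OF F]])
  qed
  note rot = integral_ball_measure_orthogonal[OF orthogonal_rotate_coords]
  have joint: "integrable (?I \<Otimes>\<^sub>M ?B) (\<lambda>(t, z). F (rotate_coords J (2 * pi * t) z))"
  proof -
    have "integrable (?I \<Otimes>\<^sub>M ?B) (\<lambda>p. F (?R p))"
    proof (rule IB.Fubini_integrable[OF meas])
      show "AE t in ?I. integrable ?B (\<lambda>z. F (?R (t, z)))"
        using rot(2)[OF F int] by simp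
      \<comment> \<open>The same invariance makes the integral of the norm constant in
        \<open>t\<close>, hence integrable over [0,1].\<close>
      have "(LINT z|?B. norm (F (?R (t, z)))) = (LINT z|?B. norm (F z))" for t
        using rot(1)[OF continuous_on_norm[OF F], of J "2 * pi * t"] by simp
      then show "integrable ?I (\<lambda>t. LINT z|?B. norm (F (?R (t, z))))"
        by simp
    qed
    then show ?thesis by (simp add: case_prod_unfold)
  qed
  show "integrable ball_measure avg"
    unfolding avg_def by (rule IB.integrable_snd[OF joint])
  have "(LINT z|?B. avg z) = (LINT t|?I. LINT z|?B. F (rotate_coords J (2 * pi * t) z))"
    unfolding avg_def by (rule IB.Fubini_integral[OF joint])
  also have "\<dots> = (LINT z|?B. F z)"
    by (simp add: rot(1)[OF F] measure_restrict_space)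
  finally show "(LINT z|ball_measure. avg z) = (LINT z|ball_measure. F z)" .
qed

section \<open>Restriction of holomorphic functions to complex lines\<close>

lemma open_complex_line_preimage: "open {c :: complex. u + c *s v \<in> (unit_ball :: (complex ^ 'n) set)}"
proof -
  have "open ((\<lambda>c. \<chi> j. u $ j + c * v $ j) -` (unit_ball :: (complex ^ 'n) set))"
    by (intro open_vimage open_unit_ball continuous_intros)
  moreover have "(\<chi> j. u $ j + c * v $ j) = u + c *s v" for c
    by (simp add: vec_eq_iff)
  ultimately show ?thesis by (simp add: vimage_def)
qed

lemma holomorphic_on_complex_line:
  fixes h :: "complex ^ 'n \<Rightarrow> complex"
  assumes h: "holomorphic_multi h unit_ball"
  shows "(\<lambda>c. h (u + c *s v)) holomorphic_on {c. u + c *s v \<in> unit_ball}"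
proof (rule holomorphic_onI)
  fix c assume "c \<in> {c. u + c *s v \<in> unit_ball}"
  then obtain d where d: "(h has_derivative (\<lambda>k. \<Sum>i\<in>UNIV. d $ i * k $ i)) (at (u + c *s v))"
    using h by (auto simp: holomorphic_multi_def)
  have line: "((\<lambda>c. u + c *s v) has_derivative (\<lambda>c. c *s v)) (at c)"
  proof -
    have "linear (\<lambda>c. c *s v)"
      by (rule linearI) (auto simp: vec_eq_iff algebra_simps)
    then have "((\<lambda>c. c *s v) has_derivative (\<lambda>c. c *s v)) (at c)"
      by (intro bounded_linear_imp_has_derivative) (simp add: linear_conv_bounded_linear)
    from has_derivative_add[OF has_derivative_const this] show ?thesis by simp
  qed
  have "((\<lambda>c. h (u + c *s v)) has_derivative (\<lambda>c. \<Sum>i\<in>UNIV. d $ i * (c *s v) $ i)) (at c)"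
    by (rule has_derivative_compose[OF line d])
  moreover have "(\<lambda>c. \<Sum>i\<in>UNIV. d $ i * (c *s v) $ i) = (*) (\<Sum>i\<in>UNIV. d $ i * v $ i)"
    by (auto simp: sum_distrib_left sum_distrib_right mult_ac)
  ultimately have "((\<lambda>c. h (u + c *s v)) has_field_derivative (\<Sum>i\<in>UNIV. d $ i * v $ i)) (at c)"
    by (simp add: has_field_derivative_def)
  then show "(\<lambda>c. h (u + c *s v)) field_differentiable at c within {c. u + c *s v \<in> unit_ball}"
    using field_differentiable_at_within field_differentiable_def by blast
qed

lemma holomorphic_multi_imp_continuous_on:
  "holomorphic_multi h unit_ball \<Longrightarrow> continuous_on unit_ball h"
  unfolding holomorphic_multi_def
  by (auto intro!: continuous_at_imp_continuous_on dest!: has_derivative_continuous)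

subsection \<open>The Bergman projection\<close>

lemma integrable_ball_measure_bounded:
  fixes F :: "complex ^ 'n \<Rightarrow> 'b::euclidean_space"
  assumes "continuous_on unit_ball F" and "\<And>z. z \<in> unit_ball \<Longrightarrow> norm (F z) \<le> C"
  shows "integrable ball_measure F"
  using assms
  by (intro finite_measure.integrable_const_bound[OF finite_measure_ball_measure, of _ C]
      borel_measurable_ball_measureI AE_I2) (auto simp: space_ball_measure)

lemma integrable_L2_product:
  fixes f g :: "complex ^ 'n \<Rightarrow> complex"
  assumes "f \<in> L2" "g \<in> L2"
  shows "integrable ball_measure (\<lambda>z. f z * cnj (g z))"
proof (rule Bochner_Integration.integrable_bound)
  show "integrable ball_measure (\<lambda>z. (cmod (f z))\<^sup>2 + (cmod (g z))\<^sup>2)"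
    using assms by (auto simp: L2_def)
  have [measurable]: "f \<in> borel_measurable ball_measure" "g \<in> borel_measurable ball_measure"
    using assms by (auto simp: L2_def)
  have [measurable]: "cnj \<in> borel_measurable borel"
    by (intro borel_measurable_continuous_onI continuous_intros)
  show "(\<lambda>z. f z * cnj (g z)) \<in> borel_measurable ball_measure"
    by measurable
  have "x * y \<le> x\<^sup>2 + y\<^sup>2" if "0 \<le> x" "0 \<le> y" for x y :: real
    using sum_squares_bound[of x y] mult_nonneg_nonneg[OF that] by simp
  then show "AE z in ball_measure. norm (f z * cnj (g z)) \<le> norm ((cmod (f z))\<^sup>2 + (cmod (g z))\<^sup>2)"
    by (intro AE_I2) (simp add: norm_mult)
qed

lemma L2_diff:
  fixes f g :: "complex ^ 'n \<Rightarrow> complex"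
  assumes "f \<in> L2" "g \<in> L2"
  shows "(\<lambda>z. f z - g z) \<in> L2"
proof -
  have [measurable]: "f \<in> borel_measurable ball_measure" "g \<in> borel_measurable ball_measure"
    using assms by (auto simp: L2_def)
  have "integrable ball_measure (\<lambda>z. (cmod (f z - g z))\<^sup>2)"
  proof (rule Bochner_Integration.integrable_bound)
    show "integrable ball_measure (\<lambda>z. 2 * (cmod (f z))\<^sup>2 + 2 * (cmod (g z))\<^sup>2)"
      using assms by (auto simp: L2_def)
    have "(cmod (x - y))\<^sup>2 \<le> 2 * (cmod x)\<^sup>2 + 2 * (cmod y)\<^sup>2" for x y
    proof -
      have "(cmod (x - y))\<^sup>2 \<le> (cmod x + cmod y)\<^sup>2"
        by (intro power_mono norm_triangle_ineq4) simp
      also have "\<dots> \<le> 2 * (cmod x)\<^sup>2 + 2 * (cmod y)\<^sup>2"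
        using sum_squares_bound[of "cmod x" "cmod y"] by (simp add: power2_sum)
      finally show ?thesis .
    qed
    then show "AE z in ball_measure. norm ((cmod (f z - g z))\<^sup>2) \<le> norm (2 * (cmod (f z))\<^sup>2 + 2 * (cmod (g z))\<^sup>2)"
      by (intro AE_I2) simp
  qed measurable
  then show ?thesis
    by (simp add: L2_def)
qed

lemma L2_inner_diff_left:
  fixes f g h :: "complex ^ 'n \<Rightarrow> complex"
  assumes "f \<in> L2" "g \<in> L2" "h \<in> L2"
  shows "L2_inner (\<lambda>z. f z - g z) h = L2_inner f h - L2_inner g h"
  using integrable_L2_product[OF assms(1,3)] integrable_L2_product[OF assms(2,3)]
  by (simp add: L2_inner_def left_diff_distrib)

lemma L2_inner_scale_left: "L2_inner (\<lambda>z. c * f z) h = c * L2_inner f h"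
  by (simp add: L2_inner_def mult.assoc)

lemma AE_eq_0_if_L2_inner_self:
  fixes f :: "complex ^ 'n \<Rightarrow> complex"
  assumes f: "f \<in> L2" and z: "L2_inner f f = 0"
  shows "AE z in ball_measure. f z = 0"
proof -
  have "complex_of_real (LINT z|ball_measure. (cmod (f z))\<^sup>2) = 0"
    using z by (simp add: L2_inner_def flip: complex_norm_square integral_complex_of_real)
  then have "(LINT z|ball_measure. (cmod (f z))\<^sup>2) = 0" by simp
  then have "AE z in ball_measure. (cmod (f z))\<^sup>2 = 0"
    using f by (subst (asm) integral_nonneg_eq_0_iff_AE) (auto simp: L2_def)
  then show ?thesis by simp
qed

lemma bergman_space_diff:
  fixes f g :: "complex ^ 'n \<Rightarrow> complex"
  assumes "f \<in> bergman_space" "g \<in> bergman_space"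
  shows "(\<lambda>z. f z - g z) \<in> bergman_space"
proof -
  have "holomorphic_multi (\<lambda>z. f z - g z) unit_ball"
    unfolding holomorphic_multi_def
  proof
    fix z :: "complex ^ 'n" assume z: "z \<in> unit_ball"
    obtain d where d: "(f has_derivative (\<lambda>k. \<Sum>i\<in>UNIV. d $ i * k $ i)) (at z)"
      using assms(1) z by (auto simp: bergman_space_def holomorphic_multi_def)
    obtain e where e: "(g has_derivative (\<lambda>k. \<Sum>i\<in>UNIV. e $ i * k $ i)) (at z)"
      using assms(2) z by (auto simp: bergman_space_def holomorphic_multi_def)
    have "((\<lambda>z. f z - g z) has_derivative (\<lambda>k. \<Sum>i\<in>UNIV. (d - e) $ i * k $ i)) (at z)"
      using has_derivative_diff[OF d e] by (simp add: sum_subtractf left_diff_distrib)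
    then show "\<exists>d. ((\<lambda>z. f z - g z) has_derivative (\<lambda>k. \<Sum>i\<in>UNIV. d $ i * k $ i)) (at z)" ..
  qed
  then show ?thesis
    using assms L2_diff by (auto simp: bergman_space_def)
qed

text \<open>The difference of \<open>P f\<close> and \<open>g\<close> lies in the Bergman space and
  is orthogonal to it, hence to itself. It therefore vanishes almost everywhere and, being
  continuous, everywhere on the ball. Projections can thus be identified from inner products,
  without the integral kernel.\<close>

lemma bergman_projection_unique:
  assumes P: "bergman_projection P" and f: "f \<in> L2" and g: "g \<in> bergman_space"
    and orth: "\<And>h. h \<in> bergman_space \<Longrightarrow> L2_inner f h = L2_inner g h"
    and z: "z \<in> unit_ball"
  shows "P f z = g z"
proof -
  have Pf: "P f \<in> bergman_space" and Pf_orth: "\<And>h. h \<in> bergman_space \<Longrightarrow> L2_inner (\<lambda>z. f z - P f z) h = 0"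
    using P f by (auto simp: bergman_projection_def)
  let ?d = "\<lambda>z. P f z - g z"
  have d: "?d \<in> bergman_space"
    by (rule bergman_space_diff[OF Pf g])
  have L2: "P f \<in> L2" "g \<in> L2" "?d \<in> L2"
    using Pf g d by (auto simp: bergman_space_def)
  have "L2_inner ?d ?d = 0"
    using Pf_orth[OF d] orth[OF d] L2 f by (simp add: L2_inner_diff_left)
  from AE_eq_0_if_L2_inner_self[OF L2(3) this] have "AE z in ball_measure. P f z = g z"
    by simp
  then show ?thesis
    using Pf g z by (intro AE_ball_measure_imp_eq)
      (auto simp: bergman_space_def holomorphic_multi_imp_continuous_on)
qed

section \<open>Monomials in one coordinate and their moments\<close>

definition coord_monomial :: "'n::finite \<Rightarrow> nat \<Rightarrow> nat \<Rightarrow> complex ^ 'n \<Rightarrow> complex" where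
  "coord_monomial i m k z = (z $ i) ^ m * cnj (z $ i) ^ k"

definition moment :: "'n::finite \<Rightarrow> nat \<Rightarrow> real" where
  "moment i s = (LINT z|(ball_measure :: (complex ^ 'n) measure). cmod (z $ i) ^ (2 * s))"

lemma norm_nth_less_1: "z \<in> unit_ball \<Longrightarrow> cmod (z $ i) < 1"
  using Finite_Cartesian_Product.norm_nth_le[of z i] by (simp add: unit_ball_def)

lemma integrable_cmod_nth_power: "integrable (ball_measure :: (complex ^ 'n) measure) (\<lambda>z. cmod (z $ i) ^ s)"
  by (rule integrable_ball_measure_bounded[of _ 1])
     (auto intro!: continuous_intros power_le_one simp: norm_power less_imp_le[OF norm_nth_less_1])

lemma continuous_on_coord_monomial [continuous_intros]: "continuous_on A (coord_monomial i m k)"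
  unfolding coord_monomial_def by (intro continuous_intros)

lemma cmod_coord_monomial_square: "(cmod (coord_monomial i m k z))\<^sup>2 = cmod (z $ i) ^ (2 * (m + k))"
  by (simp add: coord_monomial_def norm_mult norm_power power_mult_distrib power_add mult_2 power2_eq_square)

lemma L2_coord_monomial: "(\<lambda>z. c * coord_monomial i m k z) \<in> (L2 :: (complex ^ 'n \<Rightarrow> complex) set)"
proof -
  have "(\<lambda>z. c * coord_monomial i m k z) \<in> borel_measurable (ball_measure :: (complex ^ 'n) measure)"
    by (intro borel_measurable_ball_measureI continuous_intros)
  then show ?thesis
    by (simp add: L2_def norm_mult power_mult_distrib cmod_coord_monomial_square integrable_cmod_nth_power)
qed

lemma L2_norm_coord_monomial: "(L2_norm (\<lambda>z. c * coord_monomial i m k z))\<^sup>2 = (cmod c)\<^sup>2 * moment i (m + k)"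
  by (simp add: L2_norm_def moment_def norm_mult power_mult_distrib cmod_coord_monomial_square
      Bochner_Integration.integral_nonneg)

lemma bergman_coord_power: "(\<lambda>z. c * coord_monomial i p 0 z) \<in> (bergman_space :: (complex ^ 'n \<Rightarrow> complex) set)"
proof -
  have "holomorphic_multi (\<lambda>z. c * coord_monomial i p 0 z) unit_ball"
    unfolding holomorphic_multi_def
  proof
    fix z :: "complex ^ 'n"
    have "((\<lambda>w. w $ i) has_derivative (\<lambda>k. k $ i)) (at z)"
      by (rule bounded_linear_imp_has_derivative) (rule bounded_linear_vec_nth)
    moreover have "((\<lambda>x. c * x ^ p) has_derivative (*) (c * (of_nat p * (z $ i) ^ (p - 1)))) (at (z $ i))"
      by (rule has_field_derivative_imp_has_derivative) (auto intro!: derivative_eq_intros)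
    ultimately have "((\<lambda>w. c * (w $ i) ^ p) has_derivative (\<lambda>k. c * (of_nat p * (z $ i) ^ (p - 1)) * k $ i)) (at z)"
      by (rule has_derivative_compose)
    moreover have "(\<Sum>j\<in>UNIV. axis i a $ j * k $ j) = a * k $ i" for a and k :: "complex ^ 'n"
      by (simp add: axis_def if_distrib[of "\<lambda>x. x * _"] cong: if_cong)
    ultimately have "((\<lambda>z. c * coord_monomial i p 0 z) has_derivative
        (\<lambda>k. \<Sum>j\<in>UNIV. axis i (c * (of_nat p * (z $ i) ^ (p - 1))) $ j * k $ j)) (at z)"
      by (simp add: coord_monomial_def)
    then show "\<exists>d. ((\<lambda>z. c * coord_monomial i p 0 z) has_derivative (\<lambda>k. \<Sum>i\<in>UNIV. d $ i * k $ i)) (at z)" ..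
  qed
  then show ?thesis by (simp add: bergman_space_def L2_coord_monomial)
qed

lemma vector_smult_axis: "c *s axis i x = axis i (c * x)"
  for c x :: complex
  by (simp add: vec_eq_iff axis_def)

lemma axis_in_unit_ball_iff [simp]: "axis i c \<in> unit_ball \<longleftrightarrow> cmod c < 1"
  by (simp add: unit_ball_def norm_eq_sqrt_inner inner_axis_axis)

text \<open>Rotating the other coordinates moves \<open>z\<close> on a circle in a complex line
  whose centre is \<open>axis i (z $ i)\<close>, which is what the mean value property
  needs.\<close>

lemma rotate_coords_complement:
  "rotate_coords (- {i}) t z = axis i (z $ i) + cis t *s (z - axis i (z $ i))"
  by (simp add: vec_eq_iff axis_def)

text \<open>Averaging over rotations leaves only one Taylor coefficient of \<open>h\<close>. That
  factor does not involve \<open>k\<close>, so comparing with \<open>k = 0\<close> will identify the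
  projection of the monomial.\<close>

lemma L2_inner_coord_monomial:
  fixes h :: "complex ^ 'n \<Rightarrow> complex"
  assumes h: "h \<in> bergman_space"
  shows "L2_inner (coord_monomial i (p + k) k) h
           = of_real (moment i (p + k)) * cnj ((deriv ^^ p) (\<lambda>c. h (axis i c)) 0 / fact p)"
proof -
  define w :: "complex ^ 'n \<Rightarrow> complex" where "w = coord_monomial i (p + k) k"
  define H where "H = (\<lambda>c. h (axis i c))"
  have hol: "holomorphic_multi h unit_ball" and L2: "h \<in> L2"
    using h by (auto simp: bergman_space_def)
  have h_cont: "continuous_on unit_ball h"
    by (rule holomorphic_multi_imp_continuous_on[OF hol])
  let ?S = "\<lambda>u v. {c. u + c *s v \<in> (unit_ball :: (complex ^ 'n) set)}"
  define F where "F = (\<lambda>z. w z * cnj (h z))"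
  define G where "G = (\<lambda>z. w z * cnj (H (z $ i)))"
  have F_cont: "continuous_on unit_ball F"
    unfolding F_def w_def by (intro continuous_intros h_cont)
  have F_int: "integrable ball_measure F"
    unfolding F_def using L2 L2_coord_monomial[of 1] by (intro integrable_L2_product) (auto simp: w_def)
  \<comment> \<open>Rotating the other coordinates replaces \<open>h z\<close> by its mean value \<open>h (axis i (z $ i))\<close>.\<close>
  have avgF: "(LINT t|lebesgue_on {0..1}. F (rotate_coords (- {i}) (2 * pi * t) z)) = G z"
    if z: "z \<in> unit_ball" for z
  proof -
    define u v where "u = axis i (z $ i)" and "v = z - u"
    \<comment> \<open>The vector \<open>v\<close> has zero coordinate \<open>i\<close>, so shrinking
      it does not increase the norm, and the closed unit disc stays inside the domain of the
      restricted function.\<close>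
    have "u + c *s v \<in> unit_ball" if "cmod c \<le> 1" for c
    proof -
      have "norm (u + c *s v) \<le> norm z"
        using that by (intro norm_le_componentwise_cart) (simp add: u_def v_def axis_def norm_mult mult_left_le_one_le)
      then show ?thesis using z by (simp add: unit_ball_def)
    qed
    then have "cball 0 1 \<subseteq> ?S u v" by auto
    from circle_average[OF open_complex_line_preimage this holomorphic_on_complex_line[OF hol], of 0]
    have "(LINT t|lebesgue_on {0..1}. h (u + cis (2 * pi * t) *s v)) = H (z $ i)"
      by (simp add: H_def u_def)
    moreover have "u $ i = z $ i" "v $ i = 0"
      by (simp_all add: u_def v_def)
    ultimately show ?thesis
      by (simp add: F_def G_def w_def coord_monomial_def rotate_coords_complement flip: u_def v_def)
  qed
  have G_int: "integrable ball_measure G" and FG: "(LINT z|ball_measure. G z) = (LINT z|ball_measure. F z)"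
  proof -
    note avg = integral_average_rotation[OF F_cont F_int, of "- {i}"]
    show "integrable ball_measure G"
      using avg(1) avgF
      by (subst Bochner_Integration.integrable_cong[OF refl]) (auto simp: space_ball_measure)
    show "(LINT z|ball_measure. G z) = (LINT z|ball_measure. F z)"
      unfolding avg(2)[symmetric]
      by (rule Bochner_Integration.integral_cong) (auto simp: space_ball_measure avgF)
  qed
  have H_hol: "H holomorphic_on ball 0 1"
    using holomorphic_on_complex_line[OF hol, of 0 "axis i 1"]
    by (simp add: H_def vector_smult_axis ball_def)
  have G_cont: "continuous_on unit_ball G"
    unfolding G_def w_def
    by (intro continuous_intros continuous_on_compose2[OF holomorphic_on_imp_continuous_on[OF H_hol]])
       (auto simp: norm_nth_less_1)
  \<comment> \<open>Rotating the coordinate \<open>i\<close> then extracts a Taylor coefficient of \<open>H\<close>.\<close>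
  have avgG: "(LINT t|lebesgue_on {0..1}. G (rotate_coords {i} (2 * pi * t) z))
      = cmod (z $ i) ^ (2 * (p + k)) * cnj ((deriv ^^ p) H 0 / fact p)" if z: "z \<in> unit_ball" for z
  proof -
    let ?T = "(\<lambda>c. z $ i * c) -` ball 0 1"
    let ?\<phi> = "\<lambda>c. H (z $ i * c)"
    have T: "open ?T"
      by (intro open_vimage open_ball continuous_intros)
    have "cmod (z $ i) * cmod c < 1" if "cmod c \<le> 1" for c
      using norm_nth_less_1[OF z, of i] mult_left_le[OF that, of "cmod (z $ i)"] by simp
    then have "cball 0 1 \<subseteq> ?T"
      by (auto simp: norm_mult)
    moreover have "?\<phi> holomorphic_on ?T"
      using holomorphic_on_compose[of "\<lambda>c. z $ i * c" ?T H] holomorphic_on_subset[OF H_hol]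
      by (auto simp: o_def intro!: holomorphic_intros)
    ultimately have *: "(LINT t|lebesgue_on {0..1}. ?\<phi> (cis (2 * pi * t)) * cis (- (2 * pi * real p * t)))
        = (deriv ^^ p) ?\<phi> 0 / fact p"
      by (intro circle_average[OF T])
    \<comment> \<open>The dilation by \<open>z $ i\<close> contributes its power \<open>p\<close>;
      after conjugation this completes \<open>w z\<close> to a power of the squared modulus.\<close>
    have "(deriv ^^ p) ?\<phi> 0 = (z $ i) ^ p * (deriv ^^ p) H 0"
      using higher_deriv_compose_linear[OF H_hol T open_ball, of 0 "z $ i" p] by simp
    moreover have "G (rotate_coords {i} (2 * pi * t) z)
        = w z * cnj (?\<phi> (cis (2 * pi * t)) * cis (- (2 * pi * real p * t)))" for t
    proof -
      \<comment> \<open>The rotation multiplies the monomial by the phase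
        \<open>cis (real p * s)\<close>. Moved under the conjugation it becomes the weight in
        \<open>circle_average\<close>.\<close>
      have "cis s ^ (p + k) * cnj (cis s) ^ k = cis (real p * s)" for s
        by (simp add: cis_cnj Complex.DeMoivre cis_mult algebra_simps)
      from this[of "2 * pi * t"] show ?thesis
        by (simp add: G_def w_def coord_monomial_def power_mult_distrib cis_cnj mult_ac)
    qed
    ultimately have "(LINT t|lebesgue_on {0..1}. G (rotate_coords {i} (2 * pi * t) z))
        = w z * cnj ((z $ i) ^ p) * cnj ((deriv ^^ p) H 0 / fact p)"
      using * by (simp del: complex_cnj_mult) simp
    also have "w z * cnj ((z $ i) ^ p) = of_real (cmod (z $ i) ^ (2 * (p + k)))"
    proof -
      have "w z * cnj ((z $ i) ^ p) = (z $ i * cnj (z $ i)) ^ (p + k)"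
        by (simp add: w_def coord_monomial_def power_mult_distrib power_add mult_ac)
      also have "\<dots> = of_real (cmod (z $ i) ^ (2 * (p + k)))"
        unfolding complex_norm_square[symmetric] power_mult of_real_power ..
      finally show ?thesis .
    qed
    finally show ?thesis by simp
  qed
  have "L2_inner w h = (LINT z|ball_measure. G z)"
    by (simp add: L2_inner_def F_def FG)
  also have "\<dots> = (LINT z|ball_measure. LINT t|lebesgue_on {0..1}. G (rotate_coords {i} (2 * pi * t) z))"
    by (rule integral_average_rotation(2)[OF G_cont G_int, symmetric])
  also have "\<dots> = (LINT z|ball_measure. of_real (cmod ((z :: complex ^ 'n) $ i) ^ (2 * (p + k))) * cnj ((deriv ^^ p) H 0 / fact p))"
    by (rule Bochner_Integration.integral_cong) (auto simp: avgG space_ball_measure)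
  also have "\<dots> = of_real (moment i (p + k)) * cnj ((deriv ^^ p) H 0 / fact p)"
    using integrable_cmod_nth_power by (simp add: moment_def del: of_real_power)
  finally show ?thesis
    by (simp add: w_def H_def)
qed

text \<open>A vanishing moment would make the power of the coordinate zero almost everywhere, hence
  everywhere on the ball by continuity, which fails at \<open>axis i (1 / 2)\<close>.\<close>

lemma moment_pos: "moment (i :: 'n::finite) s > 0"
proof -
  have "moment i s \<noteq> 0"
  proof
    assume "moment i s = 0"
    then have "AE z in (ball_measure :: (complex ^ 'n) measure). cmod (z $ i) ^ (2 * s) = 0"
      unfolding moment_def by (subst (asm) integral_nonneg_eq_0_iff_AE) (auto intro: integrable_cmod_nth_power)
    then have ae: "AE z in (ball_measure :: (complex ^ 'n) measure). coord_monomial i s 0 z = 0"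
      by (rule AE_mp) (auto simp: coord_monomial_def)
    have "axis i (1 / 2) \<in> (unit_ball :: (complex ^ 'n) set)"
      by simp
    from AE_ball_measure_imp_eq[OF ae continuous_on_coord_monomial continuous_on_const this] show False
      by (simp add: coord_monomial_def)
  qed
  moreover have "moment i s \<ge> 0"
    by (simp add: moment_def Bochner_Integration.integral_nonneg)
  ultimately show ?thesis by simp
qed

lemma moment_decreasing: "moment (i :: 'n::finite) (Suc s) \<le> moment i s"
  unfolding moment_def
proof (rule integral_mono)
  fix z :: "complex ^ 'n" assume "z \<in> space ball_measure"
  then have "cmod (z $ i) < 1"
    by (simp add: space_ball_measure norm_nth_less_1)
  then show "cmod (z $ i) ^ (2 * Suc s) \<le> cmod (z $ i) ^ (2 * s)"
    by (intro power_decreasing) auto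
qed (rule integrable_cmod_nth_power)+

text \<open>This is the Cauchy-Schwarz inequality for the moduli of the coordinate to the powers
  \<open>s\<close> and \<open>s + 2\<close>, obtained by integrating a weighted square.\<close>

lemma moment_log_convex: "(moment (i :: 'n::finite) (Suc s))\<^sup>2 \<le> moment i s * moment i (Suc (Suc s))"
proof -
  let ?M = "moment i"
  \<comment> \<open>This value minimizes the quadratic polynomial in \<open>t\<close> that results
    from the integration.\<close>
  define t where "t = ?M (Suc s) / ?M s"
  let ?r = "\<lambda>z :: complex ^ 'n. cmod (z $ i)"
  have "0 \<le> (LINT z|ball_measure. ?r z ^ (2 * s) * ((?r z)\<^sup>2 - t)\<^sup>2)"
    by (intro Bochner_Integration.integral_nonneg) simp
  also have "(\<lambda>z. ?r z ^ (2 * s) * ((?r z)\<^sup>2 - t)\<^sup>2)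
      = (\<lambda>z. ?r z ^ (2 * Suc (Suc s)) - 2 * t * ?r z ^ (2 * Suc s) + t\<^sup>2 * ?r z ^ (2 * s))"
    by (rule ext) (simp add: power2_eq_square algebra_simps)
  also have "(LINT z|ball_measure. \<dots> z) = ?M (Suc (Suc s)) - 2 * t * ?M (Suc s) + t\<^sup>2 * ?M s"
    unfolding moment_def
    by (subst Bochner_Integration.integral_add Bochner_Integration.integral_diff
        | intro Bochner_Integration.integrable_diff integrable_mult_right integrable_cmod_nth_power
        | simp only: integral_mult_right_zero)+
  also have "\<dots> = ?M (Suc (Suc s)) - (?M (Suc s))\<^sup>2 / ?M s"
    using moment_pos[of i s] by (simp add: t_def power2_eq_square field_simps)
  finally show ?thesis
    using moment_pos[of i s] by (simp add: field_simps)
qed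

text \<open>Against every Bergman function, the monomial and the holomorphic power \<open>p\<close>
  of the coordinate have inner products that differ only by the quotient of the two moments.\<close>

lemma bergman_projection_coord_monomial:
  fixes z :: "complex ^ 'n"
  assumes P: "bergman_projection P" and z: "z \<in> unit_ball"
  shows "P (\<lambda>z. c * coord_monomial i (p + k) k z) z
           = c * of_real (moment i (p + k) / moment i p) * coord_monomial i p 0 z"
proof (rule bergman_projection_unique[OF P L2_coord_monomial bergman_coord_power _ z])
  fix h :: "complex ^ 'n \<Rightarrow> complex" assume h: "h \<in> bergman_space"
  show "L2_inner (\<lambda>z. c * coord_monomial i (p + k) k z) h
      = L2_inner (\<lambda>z. c * of_real (moment i (p + k) / moment i p) * coord_monomial i p 0 z) h"
    using moment_pos[of i p] L2_inner_coord_monomial[OF h, of i p k] L2_inner_coord_monomial[OF h, of i p 0]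
    unfolding L2_inner_scale_left by simp
qed

subsection \<open>The commutator on monomials\<close>

text \<open>The chain rule along the two real directions. \<open>D\<close> is real linear, which
  covers monomials with conjugate factors.\<close>

lemma wirtinger_deriv_eq:
  assumes D: "(f has_derivative D) (at z)"
  shows "wirtinger_deriv i f z = (D (axis i 1) - \<i> * D (axis i \<i>)) / 2"
proof -
  have "vector_derivative (\<lambda>t::real. f (z + t *\<^sub>R v)) (at 0) = D v" for v
  proof (rule vector_derivative_at)
    have "((\<lambda>t::real. z + t *\<^sub>R v) has_derivative (\<lambda>t. t *\<^sub>R v)) (at 0)"
      by (auto intro!: derivative_eq_intros)
    moreover have "(f has_derivative D) (at (z + 0 *\<^sub>R v))"
      using D by simp
    ultimately have "((\<lambda>t::real. f (z + t *\<^sub>R v)) has_derivative (\<lambda>t. D (t *\<^sub>R v))) (at 0)"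
      by (rule has_derivative_compose)
    then show "((\<lambda>t::real. f (z + t *\<^sub>R v)) has_vector_derivative D v) (at 0)"
      by (simp add: has_vector_derivative_def linear_scale[OF has_derivative_linear[OF D]])
  qed
  then show ?thesis
    by (simp add: wirtinger_deriv_def)
qed

text \<open>The formula for \<open>f\<close> is assumed on a neighbourhood because
  \<open>P f\<close> is known on the ball only. For \<open>m = 0\<close> the truncated exponent
  \<open>m - 1\<close> is harmless, since the factor \<open>of_nat m\<close> vanishes.\<close>

lemma const_derivation_coord_monomial:
  fixes f :: "complex ^ 'n \<Rightarrow> complex"
  assumes U: "open U" "z \<in> U" and f: "\<And>w. w \<in> U \<Longrightarrow> f w = c * coord_monomial i m k w"
  shows "const_derivation a f z = a $ i * (c * of_nat m * coord_monomial i (m - 1) k z)"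
proof -
  let ?x = "z $ i"
  let ?A = "of_nat m * ?x ^ (m - 1) * cnj ?x ^ k" and ?B = "of_nat k * cnj ?x ^ (k - 1) * ?x ^ m"
  let ?D = "\<lambda>v :: complex ^ 'n. c * (?A * v $ i + ?B * cnj (v $ i))"
  have nth: "((\<lambda>w. w $ i) has_derivative (\<lambda>v. v $ i)) (at z)"
    by (rule bounded_linear_imp_has_derivative) (rule bounded_linear_vec_nth)
  have cnj: "((\<lambda>w. cnj (w $ i)) has_derivative (\<lambda>v. cnj (v $ i))) (at z)"
    by (rule bounded_linear.has_derivative[OF bounded_linear_cnj nth])
  have "((\<lambda>w. c * ((w $ i) ^ m * cnj (w $ i) ^ k)) has_derivative ?D) (at z)"
    by (rule derivative_eq_intros nth cnj refl)+ (auto simp: algebra_simps)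
  then have "((\<lambda>w. c * coord_monomial i m k w) has_derivative ?D) (at z)"
    by (simp add: coord_monomial_def)
  then have D: "(f has_derivative ?D) (at z)"
    by (rule has_derivative_transform_within_open[OF _ U]) (simp add: f)
  \<comment> \<open>In direction \<open>i\<close> the two real derivatives add up to twice the
    \<open>?A\<close> term, while the \<open>?B\<close> terms cancel because conjugation changes the
    sign of the imaginary unit.\<close>
  have "wirtinger_deriv j f z = (if j = i then c * ?A else 0)" for j
    unfolding wirtinger_deriv_eq[OF D] by (simp add: axis_def algebra_simps)
  then show ?thesis
    by (simp add: const_derivation_def coord_monomial_def if_distrib[of "\<lambda>x. _ * x"] mult_ac cong: if_cong)
qed

lemma coord_monomial_in_ball_polys: "coord_monomial i m k \<in> ball_polys"
proof -
  let ?e = "\<lambda>m j. if j = i then m else (0 :: nat)"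
  have "(\<Prod>j\<in>UNIV. x j ^ ?e m j) = x i ^ m" for x :: "'a \<Rightarrow> complex" and m
    by (simp add: if_distrib[of "\<lambda>n. _ ^ n"] cong: if_cong)
  then have "coord_monomial i m k = (\<lambda>z. \<Sum>(\<alpha>, \<beta>)\<in>{(?e m, ?e k)}.
      1 * ((\<Prod>i\<in>UNIV. (z $ i) ^ \<alpha> i) * (\<Prod>i\<in>UNIV. cnj (z $ i) ^ \<beta> i)))"
    by (simp add: coord_monomial_def fun_eq_iff)
  then show ?thesis
    unfolding ball_polys_def by (intro CollectI exI[of _ "{(?e m, ?e k)}"] exI[of _ "\<lambda>_ _. 1"]) simp
qed

lemma commutator_coord_monomial:
  fixes z :: "complex ^ 'n" and i :: 'n
  assumes P: "bergman_projection P" and z: "z \<in> unit_ball"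
  defines "M \<equiv> moment i"
  shows "commutator (const_derivation a) P (coord_monomial i (q + 1 + k) k) z
    = a $ i * of_real (real (q + 1) * M (q + k + 1) / M (q + 1) - real (q + k + 1) * M (q + k) / M q)
        * coord_monomial i q 0 z"
proof -
  let ?f = "coord_monomial i (q + 1 + k) k :: complex ^ 'n \<Rightarrow> complex"
  have Pf: "P ?f w = of_real (M (q + 1 + k) / M (q + 1)) * coord_monomial i (q + 1) 0 w"
    if "w \<in> unit_ball" for w
    using bergman_projection_coord_monomial[OF P that, of 1 i "q + 1" k] by (simp add: M_def)
  have "const_derivation a (P ?f) z
      = a $ i * (of_real (M (q + 1 + k) / M (q + 1)) * of_nat (q + 1) * coord_monomial i q 0 z)"
    using const_derivation_coord_monomial[OF open_unit_ball z Pf] by simp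
  \<comment> \<open>This is an equality of functions on the whole space, so that it can be
    substituted in the argument of \<open>P\<close>.\<close>
  moreover have "const_derivation a ?f = (\<lambda>w. a $ i * of_nat (q + 1 + k) * coord_monomial i (q + k) k w)"
    using const_derivation_coord_monomial[OF open_UNIV UNIV_I, of ?f 1] by (simp add: fun_eq_iff)
  then have "P (const_derivation a ?f) z
      = a $ i * of_nat (q + 1 + k) * of_real (M (q + k) / M q) * coord_monomial i q 0 z"
    by (simp only: bergman_projection_coord_monomial[OF P z] M_def)
  ultimately show ?thesis
    by (simp add: commutator_def algebra_simps add_divide_distrib)
qed

lemma L2_norm_cong_AE:
  fixes f g :: "complex ^ 'n \<Rightarrow> complex"
  assumes "f \<in> L2" "g \<in> L2" "AE z in ball_measure. f z = g z"
  shows "L2_norm f = L2_norm g"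
proof -
  have [measurable]: "f \<in> borel_measurable ball_measure" "g \<in> borel_measurable ball_measure"
    using assms by (auto simp: L2_def)
  have "(LINT z|ball_measure. (cmod (f z))\<^sup>2) = (LINT z|ball_measure. (cmod (g z))\<^sup>2)"
    using assms(3) by (intro integral_cong_AE) auto
  then show ?thesis by (simp add: L2_norm_def)
qed

theorem corollary7p3p1:
  fixes a :: "complex ^ 'n"
    and P :: "(complex ^ 'n \<Rightarrow> complex) \<Rightarrow> complex ^ 'n \<Rightarrow> complex"
  assumes "bergman_projection P"
    and "a \<noteq> 0"
  shows "\<not> (\<exists>T. bounded_linear_on_L2 T \<and>
            (\<forall>f\<in>ball_polys. AE z in ball_measure. T f z = commutator (const_derivation a) P f z))"
proof
  assume "\<exists>T. bounded_linear_on_L2 T \<and>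
            (\<forall>f\<in>ball_polys. AE z in ball_measure. T f z = commutator (const_derivation a) P f z)"
  then obtain T C where T_L2: "\<And>f. f \<in> L2 \<Longrightarrow> T f \<in> L2"
      and T_bound: "\<And>f. f \<in> L2 \<Longrightarrow> L2_norm (T f) \<le> C * L2_norm f"
      and T_eq: "\<And>f. f \<in> ball_polys \<Longrightarrow> AE z in ball_measure. T f z = commutator (const_derivation a) P f z"
    unfolding bounded_linear_on_L2_def by blast
  obtain i where i: "a $ i \<noteq> 0"
    using assms(2) by (auto simp: vec_eq_iff)
  let ?M = "moment i"
  show False
  \<comment> \<open>The commutator carries the factor \<open>a $ i\<close>; its modulus is moved to
    the side of the bound.\<close>
  proof (rule moment_quotient_contradiction[of ?M "C / cmod (a $ i)"])
    fix k q :: nat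
    let ?f = "coord_monomial i (q + 1 + k) k :: complex ^ 'n \<Rightarrow> complex"
    define d where "d = real (q + 1) * ?M (q + k + 1) / ?M (q + 1) - real (q + k + 1) * ?M (q + k) / ?M q"
    let ?g = "\<lambda>z :: complex ^ 'n. a $ i * of_real d * coord_monomial i q 0 z"
    have f: "?f \<in> L2"
      using L2_coord_monomial[of 1] by simp
    \<comment> \<open>The formula for the commutator holds at points of the ball only.\<close>
    have "AE z in ball_measure. z \<in> (unit_ball :: (complex ^ 'n) set)"
      by (intro AE_I2) (simp add: space_ball_measure)
    with T_eq[OF coord_monomial_in_ball_polys, of i "q + 1 + k" k]
    have "AE z in ball_measure. T ?f z = ?g z"
      by eventually_elim (simp only: commutator_coord_monomial[OF assms(1)] d_def)
    then have "L2_norm (T ?f) = L2_norm ?g"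
      by (intro L2_norm_cong_AE T_L2 f L2_coord_monomial)
    then have "L2_norm ?g \<le> C * L2_norm ?f"
      using T_bound[OF f] by simp
    then have "(L2_norm ?g)\<^sup>2 \<le> C\<^sup>2 * (L2_norm ?f)\<^sup>2"
      using power_mono[of "L2_norm ?g" "C * L2_norm ?f" 2]
      by (simp add: power_mult_distrib L2_norm_def Bochner_Integration.integral_nonneg)
    then have "(cmod (a $ i))\<^sup>2 * (d\<^sup>2 * ?M q) \<le> C\<^sup>2 * ?M (q + 2 * k + 1)"
    proof -
      have "(L2_norm ?f)\<^sup>2 = ?M (q + 2 * k + 1)"
        using L2_norm_coord_monomial[of 1 i "q + 1 + k" k] by (simp add: mult_2 add_ac)
      moreover have "(L2_norm ?g)\<^sup>2 = (cmod (a $ i))\<^sup>2 * (d\<^sup>2 * ?M q)"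
        unfolding L2_norm_coord_monomial by (simp add: norm_mult power_mult_distrib)
      ultimately show ?thesis
        using \<open>(L2_norm ?g)\<^sup>2 \<le> C\<^sup>2 * (L2_norm ?f)\<^sup>2\<close> by simp
    qed
    then show "d\<^sup>2 * ?M q \<le> (C / cmod (a $ i))\<^sup>2 * ?M (q + 2 * k + 1)"
      using i by (simp add: power_divide field_simps)
  qed (rule moment_pos moment_decreasing moment_log_convex)+
qed

end
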